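(* Let $\mathcal K$ be a locally Cartesian closed and locally presentable category, and let $A,B$ be objects of $\mathcal K$. Let $D_1:\mathrm{Mre}(A,B)\to\mathrm{Mly}(A,B)$ be the functor sending a Moore machine $(E,d,s)$ to the Mealy machine $(E,d,s\circ d)$ and acting as the identity on underlying morphisms $f:E\to F$, and let $K_1:\mathrm{Mly}(A,B)\to\mathrm{Mre}(A,B)$ be its right adjoint. Then $K_1$ is naturally isomorphic to the functor $L_{\mathfrak u_B}=\mathfrak u_B\ltimes(-):\mathrm{Mly}(A,B)\to\mathrm{Mre}(A,B)$ given by post-composition with the universal Moore machine $\mathfrak u_B$.
   Context: A Mealy machine with input $A$ and output $B$ is a triple $(E,d,s)$ with $E$ an object of $\mathcal K$, $d:A\times E\to E$ and $s:A\times E\to B$. A morphism $(E,d,s)\to(F,d',s')$ in $\mathrm{Mly}(A,B)$ is a morphism $f:E\to F$ of $\mathcal K$ with $f\circ d=d'\circ(A\times f)$ and $s'\circ(A\times f)=s$. A Moore machine with input $A$ and output $B$ is a triple $(E,d,s)$ with $d:A\times E\to E$ and $s:E\to B$. A morphism $(E,d,s)\to(F,d',s')$ in $\mathrm{Mre}(A,B)$ is a morphism $f:E\to F$ of $\mathcal K$ with $f\circ d=d'\circ(A\times f)$ and $s'\circ f=s$. Composition with a Moore machine: given a Mealy machine $\mathfrak m=(E,d,s)\in\mathrm{Mly}(A,B)$ and a Moore machine $\mathfrak n=(F,d',s')\in\mathrm{Mre}(B,B)$, the Moore machine $\mathfrak n\ltimes\mathfrak m\in\mathrm{Mre}(A,B)$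 has carrier $F\times E$, transition morphism $A\times(F\times E)\to F\times E$ given, in the internal language of $\mathcal K$, by $(a,(f,e))\mapsto\big(d'(s(a,e),f),\,d(a,e)\big)$, and output morphism $(f,e)\mapsto s'(f)$. On morphisms, $\mathfrak n\ltimes g=F\times g$. This defines the functor $L_{\mathfrak n}=\mathfrak n\ltimes(-):\mathrm{Mly}(A,B)\to\mathrm{Mre}(A,B)$. The universal Moore machine $\mathfrak u_B\in\mathrm{Mre}(B,B)$ is $(B,\pi_B,\mathrm{id}_B)$, where $\pi_B:B\times B\to B$ is the projection on the first coordinate, i.e. the input coordinate: $\pi_B(b,b')=b$ with $b$ the input and $b'$ the state. The right adjoint $K_1$ of $D_1$ exists under these assumptions on $\mathcal K$. *)

theory Defs
  imports Main "HOL-Library.FuncSet"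
begin

unbundle cardinal_syntax

section \<open>Categories, functors, natural isomorphisms, adjunctions\<close>

record ('o, 'a) cat =
  Ob :: "'o set"
  Ar :: "'a set"
  Dom :: "'a \<Rightarrow> 'o"
  Cod :: "'a \<Rightarrow> 'o"
  Ident :: "'o \<Rightarrow> 'a"
  Comp :: "'a \<Rightarrow> 'a \<Rightarrow> 'a"  (infixl "\<cdot>\<index>" 70)

definition hom :: "('o, 'a) cat \<Rightarrow> 'o \<Rightarrow> 'o \<Rightarrow> 'a set" where
  "hom C x y = {f \<in> Ar C. Dom C f = x \<and> Cod C f = y}"

locale category =
  fixes C :: "('o, 'a) cat" (structure)
  assumes dom_in: "f \<in> Ar C \<Longrightarrow> Dom C f \<in> Ob C"
    and cod_in: "f \<in> Ar C \<Longrightarrow> Cod C f \<in> Ob C"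
    and ident_in: "x \<in> Ob C \<Longrightarrow> Ident C x \<in> hom C x x"
    and comp_in: "\<lbrakk>f \<in> hom C x y; g \<in> hom C y z\<rbrakk> \<Longrightarrow> g \<cdot> f \<in> hom C x z"
    and ident_left: "f \<in> hom C x y \<Longrightarrow> Ident C y \<cdot> f = f"
    and ident_right: "f \<in> hom C x y \<Longrightarrow> f \<cdot> Ident C x = f"
    and comp_assoc:
      "\<lbrakk>f \<in> hom C w x; g \<in> hom C x y; h \<in> hom C y z\<rbrakk> \<Longrightarrow> h \<cdot> (g \<cdot> f) = (h \<cdot> g) \<cdot> f"

definition is_iso :: "('o, 'a) cat \<Rightarrow> 'a \<Rightarrow> bool" where
  "is_iso C f \<longleftrightarrow> f \<in> Ar C \<and>
     (\<exists>g \<in> hom C (Cod C f) (Dom C f).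
        g \<cdot>\<^bsub>C\<^esub> f = Ident C (Dom C f) \<and> f \<cdot>\<^bsub>C\<^esub> g = Ident C (Cod C f))"

record ('o, 'a, 'p, 'b) cfunctor =
  on_ob :: "'o \<Rightarrow> 'p"
  on_ar :: "'a \<Rightarrow> 'b"

definition is_functor :: "('o, 'a) cat \<Rightarrow> ('p, 'b) cat \<Rightarrow> ('o, 'a, 'p, 'b) cfunctor \<Rightarrow> bool" where
  "is_functor C D F \<longleftrightarrow> category C \<and> category D \<and>
     (\<forall>x \<in> Ob C. on_ob F x \<in> Ob D) \<and>
     (\<forall>x y. \<forall>f \<in> hom C x y. on_ar F f \<in> hom D (on_ob F x) (on_ob F y)) \<and>
     (\<forall>x \<in> Ob C. on_ar F (Ident C x) = Ident D (on_ob F x)) \<and>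
     (\<forall>x y z. \<forall>f \<in> hom C x y. \<forall>g \<in> hom C y z.
        on_ar F (g \<cdot>\<^bsub>C\<^esub> f) = on_ar F g \<cdot>\<^bsub>D\<^esub> on_ar F f)"

definition comp_functor ::
    "('p, 'b, 'q, 'c) cfunctor \<Rightarrow> ('o, 'a, 'p, 'b) cfunctor \<Rightarrow> ('o, 'a, 'q, 'c) cfunctor" where
  "comp_functor G F =
     \<lparr>on_ob = \<lambda>x. on_ob G (on_ob F x), on_ar = \<lambda>f. on_ar G (on_ar F f)\<rparr>"

definition natural_transformation ::
    "('o, 'a) cat \<Rightarrow> ('p, 'b) cat \<Rightarrow> ('o, 'a, 'p, 'b) cfunctor \<Rightarrow> ('o, 'a, 'p, 'b) cfunctor \<Rightarrow>
     ('o \<Rightarrow> 'b) \<Rightarrow> bool" where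
  "natural_transformation C D F G \<tau> \<longleftrightarrow> is_functor C D F \<and> is_functor C D G \<and>
     (\<forall>x \<in> Ob C. \<tau> x \<in> hom D (on_ob F x) (on_ob G x)) \<and>
     (\<forall>x y. \<forall>f \<in> hom C x y. \<tau> y \<cdot>\<^bsub>D\<^esub> on_ar F f = on_ar G f \<cdot>\<^bsub>D\<^esub> \<tau> x)"

definition naturally_isomorphic ::
    "('o, 'a) cat \<Rightarrow> ('p, 'b) cat \<Rightarrow> ('o, 'a, 'p, 'b) cfunctor \<Rightarrow> ('o, 'a, 'p, 'b) cfunctor \<Rightarrow> bool"
  where
  "naturally_isomorphic C D F G \<longleftrightarrow>
     (\<exists>\<tau>. natural_transformation C D F G \<tau> \<and> (\<forall>x \<in> Ob C. is_iso D (\<tau> x)))"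

definition right_adjoint ::
    "('o, 'a) cat \<Rightarrow> ('p, 'b) cat \<Rightarrow> ('o, 'a, 'p, 'b) cfunctor \<Rightarrow> ('p, 'b, 'o, 'a) cfunctor \<Rightarrow> bool"
  where
  "right_adjoint C D F G \<longleftrightarrow> is_functor C D F \<and> is_functor D C G \<and>
     (\<exists>\<phi>.
        (\<forall>x \<in> Ob C. \<forall>y \<in> Ob D. bij_betw (\<phi> x y) (hom D (on_ob F x) y) (hom C x (on_ob G y))) \<and>
        (\<forall>x \<in> Ob C. \<forall>y \<in> Ob D. \<forall>f \<in> hom D (on_ob F x) y.
           (\<forall>x'. \<forall>u \<in> hom C x' x. \<phi> x' y (f \<cdot>\<^bsub>D\<^esub> on_ar F u) = \<phi> x y f \<cdot>\<^bsub>C\<^esub> u) \<and>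
           (\<forall>y'. \<forall>v \<in> hom D y y'. \<phi> x y' (v \<cdot>\<^bsub>D\<^esub> f) = on_ar G v \<cdot>\<^bsub>C\<^esub> \<phi> x y f)))"


section \<open>Binary products, cartesian closed and locally cartesian closed categories\<close>

record ('o, 'a) products =
  Prod :: "'o \<Rightarrow> 'o \<Rightarrow> 'o"
  Pr1 :: "'o \<Rightarrow> 'o \<Rightarrow> 'a"
  Pr2 :: "'o \<Rightarrow> 'o \<Rightarrow> 'a"

definition binary_products :: "('o, 'a) cat \<Rightarrow> ('o, 'a) products \<Rightarrow> bool" where
  "binary_products C P \<longleftrightarrow>
     (\<forall>x \<in> Ob C. \<forall>y \<in> Ob C.
        Prod P x y \<in> Ob C \<and>
        Pr1 P x y \<in> hom C (Prod P x y) x \<and>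
        Pr2 P x y \<in> hom C (Prod P x y) y \<and>
        (\<forall>z \<in> Ob C. \<forall>f \<in> hom C z x. \<forall>g \<in> hom C z y.
           \<exists>!h. h \<in> hom C z (Prod P x y) \<and>
                Pr1 P x y \<cdot>\<^bsub>C\<^esub> h = f \<and> Pr2 P x y \<cdot>\<^bsub>C\<^esub> h = g))"

definition pair :: "('o, 'a) cat \<Rightarrow> ('o, 'a) products \<Rightarrow> 'a \<Rightarrow> 'a \<Rightarrow> 'a" where
  "pair C P f g =
     (THE h. h \<in> hom C (Dom C f) (Prod P (Cod C f) (Cod C g)) \<and>
             Pr1 P (Cod C f) (Cod C g) \<cdot>\<^bsub>C\<^esub> h = f \<and> Pr2 P (Cod C f) (Cod C g) \<cdot>\<^bsub>C\<^esub> h = g)"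

definition prod_map :: "('o, 'a) cat \<Rightarrow> ('o, 'a) products \<Rightarrow> 'a \<Rightarrow> 'a \<Rightarrow> 'a" where
  "prod_map C P f g =
     pair C P (f \<cdot>\<^bsub>C\<^esub> Pr1 P (Dom C f) (Dom C g)) (g \<cdot>\<^bsub>C\<^esub> Pr2 P (Dom C f) (Dom C g))"

definition is_terminal :: "('o, 'a) cat \<Rightarrow> 'o \<Rightarrow> bool" where
  "is_terminal C t \<longleftrightarrow> t \<in> Ob C \<and> (\<forall>x \<in> Ob C. \<exists>!f. f \<in> hom C x t)"

definition is_exponential ::
    "('o, 'a) cat \<Rightarrow> ('o, 'a) products \<Rightarrow> 'o \<Rightarrow> 'o \<Rightarrow> 'o \<Rightarrow> 'a \<Rightarrow> bool" where
  "is_exponential C P b c e ev \<longleftrightarrow> e \<in> Ob C \<and> ev \<in> hom C (Prod P e b) c \<and>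
     (\<forall>x \<in> Ob C. \<forall>g \<in> hom C (Prod P x b) c.
        \<exists>!h. h \<in> hom C x e \<and> ev \<cdot>\<^bsub>C\<^esub> prod_map C P h (Ident C b) = g)"

definition cartesian_closed :: "('o, 'a) cat \<Rightarrow> bool" where
  "cartesian_closed C \<longleftrightarrow> category C \<and> (\<exists>t. is_terminal C t) \<and>
     (\<exists>P. binary_products C P \<and>
        (\<forall>b \<in> Ob C. \<forall>c \<in> Ob C. \<exists>e ev. is_exponential C P b c e ev))"

text \<open>An arrow of the slice over \<open>x\<close> from \<open>f\<close> to \<open>g\<close> is the triple \<open>(f, h, g)\<close> with
  \<open>g \<cdot> h = f\<close>: the underlying arrow \<open>h\<close> does not determine its ends.\<close>

definition slice :: "('o, 'a) cat \<Rightarrow> 'o \<Rightarrow> ('a, 'a \<times> 'a \<times> 'a) cat" where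
  "slice C x =
     \<lparr>Ob = {f \<in> Ar C. Cod C f = x},
      Ar = {(f, h, g). f \<in> Ar C \<and> Cod C f = x \<and> g \<in> Ar C \<and> Cod C g = x \<and>
              h \<in> hom C (Dom C f) (Dom C g) \<and> g \<cdot>\<^bsub>C\<^esub> h = f},
      Dom = (\<lambda>(f, h, g). f),
      Cod = (\<lambda>(f, h, g). g),
      Ident = (\<lambda>f. (f, Ident C (Dom C f), f)),
      Comp = (\<lambda>(_, k, l) (f, h, _). (f, k \<cdot>\<^bsub>C\<^esub> h, l))\<rparr>"

definition locally_cartesian_closed :: "('o, 'a) cat \<Rightarrow> bool" where
  "locally_cartesian_closed C \<longleftrightarrow> category C \<and> (\<forall>x \<in> Ob C. cartesian_closed (slice C x))"


section \<open>Locally presentable categories\<close>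

text \<open>Smallness is relative to a type \<open>'u\<close>: a set is small if its cardinality is strictly below
  that of \<open>'u\<close>. When the latter is strongly inaccessible this is smallness with respect to a
  Grothendieck universe. HOL does not prove that inaccessible types exist, so inaccessibility is
  not made part of the definitions; statements about an arbitrary \<open>'u\<close> cover that case.
  Every small category is isomorphic to one whose objects and arrows are elements of \<open>'u\<close>, so
  small diagrams may be indexed by categories of that form.\<close>

definition small :: "'u itself \<Rightarrow> 'x set \<Rightarrow> bool" where
  "small _ X \<longleftrightarrow> |X| <o |UNIV :: 'u set|"

definition locally_small :: "'u itself \<Rightarrow> ('o, 'a) cat \<Rightarrow> bool" where
  "locally_small U C \<longleftrightarrow> (\<forall>x \<in> Ob C. \<forall>y \<in> Ob C. small U (hom C x y))"

definition is_cocone ::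
    "('i, 'j) cat \<Rightarrow> ('o, 'a) cat \<Rightarrow> ('i, 'j, 'o, 'a) cfunctor \<Rightarrow> 'o \<Rightarrow> ('i \<Rightarrow> 'a) \<Rightarrow> bool" where
  "is_cocone J C F c \<iota> \<longleftrightarrow> c \<in> Ob C \<and> (\<forall>i \<in> Ob J. \<iota> i \<in> hom C (on_ob F i) c) \<and>
     (\<forall>i k. \<forall>u \<in> hom J i k. \<iota> k \<cdot>\<^bsub>C\<^esub> on_ar F u = \<iota> i)"

definition is_colimit ::
    "('i, 'j) cat \<Rightarrow> ('o, 'a) cat \<Rightarrow> ('i, 'j, 'o, 'a) cfunctor \<Rightarrow> 'o \<Rightarrow> ('i \<Rightarrow> 'a) \<Rightarrow> bool" where
  "is_colimit J C F c \<iota> \<longleftrightarrow> is_functor J C F \<and> is_cocone J C F c \<iota> \<and>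
     (\<forall>c' \<iota>'. is_cocone J C F c' \<iota>' \<longrightarrow>
        (\<exists>!h. h \<in> hom C c c' \<and> (\<forall>i \<in> Ob J. h \<cdot>\<^bsub>C\<^esub> \<iota> i = \<iota>' i)))"

definition cocomplete :: "'u itself \<Rightarrow> ('o, 'a) cat \<Rightarrow> bool" where
  "cocomplete U C \<longleftrightarrow>
     (\<forall>(J :: ('u, 'u) cat) F. small U (Ob J) \<and> small U (Ar J) \<and> is_functor J C F \<longrightarrow>
        (\<exists>c \<iota>. is_colimit J C F c \<iota>))"

definition poset_cat :: "'i set \<Rightarrow> 'i rel \<Rightarrow> ('i, 'i \<times> 'i) cat" where
  "poset_cat I r =
     \<lparr>Ob = I, Ar = r, Dom = fst, Cod = snd, Ident = (\<lambda>i. (i, i)),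
      Comp = (\<lambda>(_, k) (i, _). (i, k))\<rparr>"

text \<open>Cardinals are represented, as in the HOL library, by well-orders; every infinite cardinal
  below that of \<open>'u\<close> has a representative on \<open>'u\<close>.\<close>

definition small_regular_cardinal :: "'u itself \<Rightarrow> 'u rel \<Rightarrow> bool" where
  "small_regular_cardinal _ \<kappa> \<longleftrightarrow>
     Card_order \<kappa> \<and> infinite (Field \<kappa>) \<and> regularCard \<kappa> \<and> \<kappa> <o |UNIV :: 'u set|"

definition directed_poset :: "'u rel \<Rightarrow> 'i set \<Rightarrow> 'i rel \<Rightarrow> bool" where
  "directed_poset \<kappa> I r \<longleftrightarrow> partial_order_on I r \<and>
     (\<forall>S \<subseteq> I. |S| <o \<kappa> \<longrightarrow> (\<exists>k \<in> I. \<forall>i \<in> S. (i, k) \<in> r))"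

text \<open>The category of subsets of a type \<open>'x\<close> and all functions between them. It is the target of
  the hom-functors of a category with arrows in \<open>'x\<close>. That a cocone of sets over a nonempty
  diagram is a colimit can be tested on maps into a two-element set (and the only case where \<open>'x\<close>
  has no two-element subset is that of a category with at most one arrow, where directed colimits
  are trivial), so colimits in \<open>set_cat\<close> of diagrams of hom-sets are colimits of sets.\<close>

definition set_cat :: "('x set, 'x set \<times> ('x \<Rightarrow> 'x) \<times> 'x set) cat" where
  "set_cat =
     \<lparr>Ob = UNIV,
      Ar = {(X, f, Y). f \<in> X \<rightarrow>\<^sub>E Y},
      Dom = (\<lambda>(X, f, Y). X),
      Cod = (\<lambda>(X, f, Y). Y),
      Ident = (\<lambda>X. (X, \<lambda>x \<in> X. x, X)),
      Comp = (\<lambda>(_, g, Z) (X, f, _). (X, compose X g f, Z))\<rparr>"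

definition hom_functor ::
    "('o, 'a) cat \<Rightarrow> 'o \<Rightarrow> ('o, 'a, 'a set, 'a set \<times> ('a \<Rightarrow> 'a) \<times> 'a set) cfunctor" where
  "hom_functor C x =
     \<lparr>on_ob = hom C x,
      on_ar = (\<lambda>f. (hom C x (Dom C f), \<lambda>g \<in> hom C x (Dom C f). f \<cdot>\<^bsub>C\<^esub> g, hom C x (Cod C f)))\<rparr>"

definition presentable :: "'u itself \<Rightarrow> 'u rel \<Rightarrow> ('o, 'a) cat \<Rightarrow> 'o \<Rightarrow> bool" where
  "presentable U \<kappa> C x \<longleftrightarrow> x \<in> Ob C \<and>
     (\<forall>(I :: 'u set) r F c \<iota>.
        small U I \<and> directed_poset \<kappa> I r \<and> is_colimit (poset_cat I r) C F c \<iota> \<longrightarrow>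
        is_colimit (poset_cat I r) set_cat (comp_functor (hom_functor C x) F)
          (on_ob (hom_functor C x) c) (\<lambda>i. on_ar (hom_functor C x) (\<iota> i)))"

definition locally_presentable :: "'u itself \<Rightarrow> ('o, 'a) cat \<Rightarrow> bool" where
  "locally_presentable U C \<longleftrightarrow> category C \<and> locally_small U C \<and> cocomplete U C \<and>
     (\<exists>\<kappa>. small_regular_cardinal U \<kappa> \<and>
        (\<exists>G. G \<subseteq> Ob C \<and> small U G \<and> (\<forall>g \<in> G. presentable U \<kappa> C g) \<and>
           (\<forall>x \<in> Ob C. \<exists>(I :: 'u set) r F \<iota>.
              small U I \<and> directed_poset \<kappa> I r \<and> (\<forall>i \<in> I. on_ob F i \<in> G) \<and>
              is_colimit (poset_cat I r) C F x \<iota>)))"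


section \<open>Mealy and Moore machines\<close>

text \<open>A machine is a triple \<open>(E, d, s)\<close> of carrier, transition and output. As in the slices, an
  arrow of machines is the triple \<open>(m, f, n)\<close> of its source, underlying arrow and target. Products
  \<open>A \<times> E\<close> are those of a given choice \<open>P\<close> of binary products.\<close>

type_synonym ('o, 'a) machine = "'o \<times> 'a \<times> 'a"
type_synonym ('o, 'a) machine_ar = "('o, 'a) machine \<times> 'a \<times> ('o, 'a) machine"

definition mealy_machines ::
    "('o, 'a) cat \<Rightarrow> ('o, 'a) products \<Rightarrow> 'o \<Rightarrow> 'o \<Rightarrow> ('o, 'a) machine set" where
  "mealy_machines K P A B =
     {(E, d, s). E \<in> Ob K \<and> d \<in> hom K (Prod P A E) E \<and> s \<in> hom K (Prod P A E) B}"

definition moore_machines ::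
    "('o, 'a) cat \<Rightarrow> ('o, 'a) products \<Rightarrow> 'o \<Rightarrow> 'o \<Rightarrow> ('o, 'a) machine set" where
  "moore_machines K P A B =
     {(E, d, s). E \<in> Ob K \<and> d \<in> hom K (Prod P A E) E \<and> s \<in> hom K E B}"

definition Mly ::
    "('o, 'a) cat \<Rightarrow> ('o, 'a) products \<Rightarrow> 'o \<Rightarrow> 'o \<Rightarrow> (('o, 'a) machine, ('o, 'a) machine_ar) cat"
  where
  "Mly K P A B =
     \<lparr>Ob = mealy_machines K P A B,
      Ar = {((E, d, s), f, (F, d', s')).
              (E, d, s) \<in> mealy_machines K P A B \<and> (F, d', s') \<in> mealy_machines K P A B \<and>
              f \<in> hom K E F \<and>
              f \<cdot>\<^bsub>K\<^esub> d = d' \<cdot>\<^bsub>K\<^esub> prod_map K P (Ident K A) f \<and>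
              s' \<cdot>\<^bsub>K\<^esub> prod_map K P (Ident K A) f = s},
      Dom = (\<lambda>(m, f, n). m),
      Cod = (\<lambda>(m, f, n). n),
      Ident = (\<lambda>(E, d, s). ((E, d, s), Ident K E, (E, d, s))),
      Comp = (\<lambda>(_, g, n) (m, f, _). (m, g \<cdot>\<^bsub>K\<^esub> f, n))\<rparr>"

definition Mre ::
    "('o, 'a) cat \<Rightarrow> ('o, 'a) products \<Rightarrow> 'o \<Rightarrow> 'o \<Rightarrow> (('o, 'a) machine, ('o, 'a) machine_ar) cat"
  where
  "Mre K P A B =
     \<lparr>Ob = moore_machines K P A B,
      Ar = {((E, d, s), f, (F, d', s')).
              (E, d, s) \<in> moore_machines K P A B \<and> (F, d', s') \<in> moore_machines K P A B \<and>
              f \<in> hom K E F \<and>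
              f \<cdot>\<^bsub>K\<^esub> d = d' \<cdot>\<^bsub>K\<^esub> prod_map K P (Ident K A) f \<and>
              s' \<cdot>\<^bsub>K\<^esub> f = s},
      Dom = (\<lambda>(m, f, n). m),
      Cod = (\<lambda>(m, f, n). n),
      Ident = (\<lambda>(E, d, s). ((E, d, s), Ident K E, (E, d, s))),
      Comp = (\<lambda>(_, g, n) (m, f, _). (m, g \<cdot>\<^bsub>K\<^esub> f, n))\<rparr>"

type_synonym ('o, 'a) machine_functor =
  "(('o, 'a) machine, ('o, 'a) machine_ar, ('o, 'a) machine, ('o, 'a) machine_ar) cfunctor"

definition D\<^sub>1_ob :: "('o, 'a) cat \<Rightarrow> ('o, 'a) machine \<Rightarrow> ('o, 'a) machine" where
  "D\<^sub>1_ob K = (\<lambda>(E, d, s). (E, d, s \<cdot>\<^bsub>K\<^esub> d))"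

definition D\<^sub>1 :: "('o, 'a) cat \<Rightarrow> ('o, 'a) machine_functor" where
  "D\<^sub>1 K =
     \<lparr>on_ob = D\<^sub>1_ob K,
      on_ar = (\<lambda>(m, f, n). (D\<^sub>1_ob K m, f, D\<^sub>1_ob K n))\<rparr>"

text \<open>\<open>n \<ltimes> m\<close>. In the internal language the transition is
  \<open>(a, (f, e)) \<mapsto> (d' (s (a, e), f), d (a, e))\<close>; below \<open>a\<close>, \<open>f\<close>, \<open>e\<close> are the three projections
  from \<open>A \<times> (F \<times> E)\<close>.\<close>

definition ltimes_ob ::
    "('o, 'a) cat \<Rightarrow> ('o, 'a) products \<Rightarrow> 'o \<Rightarrow> ('o, 'a) machine \<Rightarrow> ('o, 'a) machine \<Rightarrow>
     ('o, 'a) machine" where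
  "ltimes_ob K P A = (\<lambda>(F, d', s') (E, d, s).
     let FE = Prod P F E;
         a = Pr1 P A FE;
         f = Pr1 P F E \<cdot>\<^bsub>K\<^esub> Pr2 P A FE;
         e = Pr2 P F E \<cdot>\<^bsub>K\<^esub> Pr2 P A FE
     in (FE,
         pair K P (d' \<cdot>\<^bsub>K\<^esub> pair K P (s \<cdot>\<^bsub>K\<^esub> pair K P a e) f) (d \<cdot>\<^bsub>K\<^esub> pair K P a e),
         s' \<cdot>\<^bsub>K\<^esub> Pr1 P F E))"

definition ltimes_functor ::
    "('o, 'a) cat \<Rightarrow> ('o, 'a) products \<Rightarrow> 'o \<Rightarrow> ('o, 'a) machine \<Rightarrow> ('o, 'a) machine_functor" where
  "ltimes_functor K P A n =
     \<lparr>on_ob = ltimes_ob K P A n,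
      on_ar = (\<lambda>(m, g, m').
        (ltimes_ob K P A n m, prod_map K P (Ident K (fst n)) g, ltimes_ob K P A n m'))\<rparr>"

definition universal_moore ::
    "('o, 'a) cat \<Rightarrow> ('o, 'a) products \<Rightarrow> 'o \<Rightarrow> ('o, 'a) machine" where
  "universal_moore K P B = (B, Pr1 P B B, Ident K B)"

end

theory Submission
  imports Defs
begin

text \<open>A Moore morphism from \<open>(E, d, s)\<close> to \<open>u\<^sub>B \<ltimes> (F, d', s')\<close> is a map
  \<open>E \<rightarrow> B \<times> F\<close>. Compatibility with the outputs forces its first component to be \<open>s\<close>;
  compatibility with the transitions then says that its second component \<open>g\<close> satisfies
  \<open>g \<cdot> d = d' \<cdot> (A \<times> g)\<close> and \<open>s \<cdot> d = s' \<cdot> (A \<times> g)\<close>, that is, that \<open>g\<close> is a Mealy morphism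
  from \<open>D\<^sub>1 (E, d, s)\<close> to \<open>(F, d', s')\<close>. Hence \<open>u\<^sub>B \<ltimes> (-)\<close> is right adjoint to \<open>D\<^sub>1\<close>, and
  right adjoints are unique up to natural isomorphism.\<close>

section \<open>Uniqueness of right adjoints\<close>

text \<open>\<open>right_adjoint\<close> hides the hom-set bijection behind an existential
  quantifier. Here it is a parameter, so that the counit and the comparison arrows can be built from
  it.\<close>

definition adjunction ::
    "('o, 'a) cat \<Rightarrow> ('p, 'b) cat \<Rightarrow> ('o, 'a, 'p, 'b) cfunctor \<Rightarrow> ('p, 'b, 'o, 'a) cfunctor \<Rightarrow>
     ('o \<Rightarrow> 'p \<Rightarrow> 'b \<Rightarrow> 'a) \<Rightarrow> bool"
  where
  "adjunction C D F G \<phi> \<longleftrightarrow> is_functor C D F \<and> is_functor D C G \<and>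
     (\<forall>x \<in> Ob C. \<forall>y \<in> Ob D. bij_betw (\<phi> x y) (hom D (on_ob F x) y) (hom C x (on_ob G y))) \<and>
     (\<forall>x \<in> Ob C. \<forall>y \<in> Ob D. \<forall>f \<in> hom D (on_ob F x) y.
        (\<forall>x'. \<forall>u \<in> hom C x' x. \<phi> x' y (f \<cdot>\<^bsub>D\<^esub> on_ar F u) = \<phi> x y f \<cdot>\<^bsub>C\<^esub> u) \<and>
        (\<forall>y'. \<forall>v \<in> hom D y y'. \<phi> x y' (v \<cdot>\<^bsub>D\<^esub> f) = on_ar G v \<cdot>\<^bsub>C\<^esub> \<phi> x y f))"

lemma right_adjoint_iff: "right_adjoint C D F G \<longleftrightarrow> (\<exists>\<phi>. adjunction C D F G \<phi>)"
  unfolding right_adjoint_def adjunction_def by blast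

text \<open>Cited by number below: (6) and (7) split bijectivity into surjectivity and injectivity,
  (8) is naturality in \<open>x\<close>, and (9) naturality in \<open>y\<close>.\<close>

lemma adjunctionD:
  assumes "adjunction C D F G \<phi>"
  shows "is_functor C D F" "is_functor D C G" "category C" "category D"
    and "y \<in> Ob D \<Longrightarrow> on_ob G y \<in> Ob C"
    and "x \<in> Ob C \<Longrightarrow> y \<in> Ob D \<Longrightarrow>
      \<phi> x y ` hom D (on_ob F x) y = hom C x (on_ob G y)"
    and "x \<in> Ob C \<Longrightarrow> y \<in> Ob D \<Longrightarrow> inj_on (\<phi> x y) (hom D (on_ob F x) y)"
    and "x \<in> Ob C \<Longrightarrow> y \<in> Ob D \<Longrightarrow> f \<in> hom D (on_ob F x) y \<Longrightarrow> u \<in> hom C x' x \<Longrightarrow>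
      \<phi> x' y (f \<cdot>\<^bsub>D\<^esub> on_ar F u) = \<phi> x y f \<cdot>\<^bsub>C\<^esub> u"
    and "x \<in> Ob C \<Longrightarrow> y \<in> Ob D \<Longrightarrow> f \<in> hom D (on_ob F x) y \<Longrightarrow> v \<in> hom D y y' \<Longrightarrow>
      \<phi> x y' (v \<cdot>\<^bsub>D\<^esub> f) = on_ar G v \<cdot>\<^bsub>C\<^esub> \<phi> x y f"
  using assms by (simp_all add: adjunction_def is_functor_def bij_betw_def)

section \<open>Counit and comparison of two right adjoints\<close>

definition counit ::
    "('o, 'a) cat \<Rightarrow> ('p, 'b) cat \<Rightarrow> ('o, 'a, 'p, 'b) cfunctor \<Rightarrow> ('p, 'b, 'o, 'a) cfunctor \<Rightarrow>
     ('o \<Rightarrow> 'p \<Rightarrow> 'b \<Rightarrow> 'a) \<Rightarrow> 'p \<Rightarrow> 'b"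
  where
  "counit C D F G \<phi> y =
     inv_into (hom D (on_ob F (on_ob G y)) y) (\<phi> (on_ob G y) y) (Ident C (on_ob G y))"

lemma
  assumes adj: "adjunction C D F G \<phi>" and y: "y \<in> Ob D"
  shows counit_in: "counit C D F G \<phi> y \<in> hom D (on_ob F (on_ob G y)) y"
    and transpose_counit: "\<phi> (on_ob G y) y (counit C D F G \<phi> y) = Ident C (on_ob G y)"
proof -
  interpret C: category C using adjunctionD(3)[OF adj] .
  have gy: "on_ob G y \<in> Ob C" using adjunctionD(5)[OF adj y] .
  have "Ident C (on_ob G y) \<in> \<phi> (on_ob G y) y ` hom D (on_ob F (on_ob G y)) y"
    using adjunctionD(6)[OF adj gy y] C.ident_in[OF gy] by simp
  then show "counit C D F G \<phi> y \<in> hom D (on_ob F (on_ob G y)) y"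
    "\<phi> (on_ob G y) y (counit C D F G \<phi> y) = Ident C (on_ob G y)"
    unfolding counit_def by (rule inv_into_into, rule f_inv_into_f)
qed

text \<open>The Yoneda arrow from \<open>G y\<close> to \<open>H y\<close>: the identity of
  \<open>G y\<close> is carried back along \<open>\<phi>\<close> to the counit and then forward
  along \<open>\<psi>\<close>.\<close>

definition comparison ::
    "('o, 'a) cat \<Rightarrow> ('p, 'b) cat \<Rightarrow> ('o, 'a, 'p, 'b) cfunctor \<Rightarrow> ('p, 'b, 'o, 'a) cfunctor \<Rightarrow>
     ('o \<Rightarrow> 'p \<Rightarrow> 'b \<Rightarrow> 'a) \<Rightarrow> ('o \<Rightarrow> 'p \<Rightarrow> 'b \<Rightarrow> 'a) \<Rightarrow> 'p \<Rightarrow> 'a"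
  where
  "comparison C D F G \<phi> \<psi> y = \<psi> (on_ob G y) y (counit C D F G \<phi> y)"

lemma
  assumes adj: "adjunction C D F G \<phi>" and adj': "adjunction C D F H \<psi>" and y: "y \<in> Ob D"
  shows comparison_in: "comparison C D F G \<phi> \<psi> y \<in> hom C (on_ob G y) (on_ob H y)"
    and comparison_transpose: "\<lbrakk>x \<in> Ob C; f \<in> hom D (on_ob F x) y\<rbrakk> \<Longrightarrow>
      comparison C D F G \<phi> \<psi> y \<cdot>\<^bsub>C\<^esub> \<phi> x y f = \<psi> x y f"
proof -
  interpret C: category C using adjunctionD(3)[OF adj] .
  interpret D: category D using adjunctionD(4)[OF adj] .
  let ?g = "on_ob G y" and ?e = "counit C D F G \<phi> y"
  have g: "?g \<in> Ob C" using adjunctionD(5)[OF adj y] .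
  have e: "?e \<in> hom D (on_ob F ?g) y" using counit_in[OF adj y] .
  show "comparison C D F G \<phi> \<psi> y \<in> hom C ?g (on_ob H y)"
    using adjunctionD(6)[OF adj' g y] e unfolding comparison_def by blast
  assume x: "x \<in> Ob C" and f: "f \<in> hom D (on_ob F x) y"
  let ?u = "\<phi> x y f"
  have u: "?u \<in> hom C x ?g" using adjunctionD(6)[OF adj x y] f by blast
  have Fu: "on_ar F ?u \<in> hom D (on_ob F x) (on_ob F ?g)"
    using adjunctionD(1)[OF adj] u unfolding is_functor_def by blast
  \<comment> \<open>Any \<open>f\<close> factors as the counit after \<open>F\<close> of its
    transpose \<open>?u\<close>: both arrows have transpose \<open>?u\<close>, and
    \<open>\<phi>\<close> is injective. Naturality of \<open>\<psi>\<close> in \<open>x\<close>,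
    applied to this factorization, then gives the claim.\<close>
  have "\<phi> x y (?e \<cdot>\<^bsub>D\<^esub> on_ar F ?u) = Ident C ?g \<cdot>\<^bsub>C\<^esub> ?u"
    using adjunctionD(8)[OF adj g y e u] transpose_counit[OF adj y] by simp
  also have "\<dots> = ?u" using C.ident_left[OF u] .
  finally have "?e \<cdot>\<^bsub>D\<^esub> on_ar F ?u = f"
    using adjunctionD(7)[OF adj x y] D.comp_in[OF Fu e] f by (auto dest: inj_onD)
  then show "comparison C D F G \<phi> \<psi> y \<cdot>\<^bsub>C\<^esub> ?u = \<psi> x y f"
    using adjunctionD(8)[OF adj' g y e u] unfolding comparison_def by simp
qed

text \<open>The first comparison arrow is itself a \<open>\<psi>\<close>-transpose, that of the
  counit. The opposite comparison turns it into the \<open>\<phi>\<close>-transpose of the counit,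
  which is the identity.\<close>

lemma comparison_inverse:
  assumes adj: "adjunction C D F G \<phi>" and adj': "adjunction C D F H \<psi>" and y: "y \<in> Ob D"
  shows "comparison C D F H \<psi> \<phi> y \<cdot>\<^bsub>C\<^esub> comparison C D F G \<phi> \<psi> y = Ident C (on_ob G y)"
proof -
  have "comparison C D F H \<psi> \<phi> y \<cdot>\<^bsub>C\<^esub> comparison C D F G \<phi> \<psi> y
      = \<phi> (on_ob G y) y (counit C D F G \<phi> y)"
    using comparison_transpose[OF adj' adj y adjunctionD(5)[OF adj y] counit_in[OF adj y]]
    unfolding comparison_def[of C D F G] .
  then show ?thesis using transpose_counit[OF adj y] by simp
qed

theorem right_adjoint_unique:
  assumes "right_adjoint C D F G" and "right_adjoint C D F H"
  shows "naturally_isomorphic D C G H"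
proof -
  obtain \<phi> \<psi> where adj: "adjunction C D F G \<phi>" and adj': "adjunction C D F H \<psi>"
    using assms unfolding right_adjoint_iff by blast
  interpret C: category C using adjunctionD(3)[OF adj] .
  interpret D: category D using adjunctionD(4)[OF adj] .
  let ?t = "comparison C D F G \<phi> \<psi>"
  have nat: "?t y' \<cdot>\<^bsub>C\<^esub> on_ar G v = on_ar H v \<cdot>\<^bsub>C\<^esub> ?t y" if v: "v \<in> hom D y y'" for y y' v
  proof -
    have y: "y \<in> Ob D" and y': "y' \<in> Ob D"
      using v D.dom_in D.cod_in unfolding hom_def by auto
    let ?g = "on_ob G y" and ?e = "counit C D F G \<phi> y"
    have g: "?g \<in> Ob C" using adjunctionD(5)[OF adj y] .
    have e: "?e \<in> hom D (on_ob F ?g) y" using counit_in[OF adj y] .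
    have Gv: "on_ar G v \<in> hom C ?g (on_ob G y')"
      using adjunctionD(2)[OF adj] v unfolding is_functor_def by blast
    \<comment> \<open>Naturality in \<open>y\<close> exhibits \<open>G v\<close> as the transpose of
      \<open>v\<close> after the counit. The comparison replaces \<open>\<phi>\<close> by
      \<open>\<psi>\<close> there, and naturality of \<open>\<psi>\<close> pulls \<open>v\<close>
      out again as \<open>H v\<close>.\<close>
    have "on_ar G v = \<phi> ?g y' (v \<cdot>\<^bsub>D\<^esub> ?e)"
      using adjunctionD(9)[OF adj g y e v] transpose_counit[OF adj y] C.ident_right[OF Gv] by simp
    then have "?t y' \<cdot>\<^bsub>C\<^esub> on_ar G v = \<psi> ?g y' (v \<cdot>\<^bsub>D\<^esub> ?e)"
      using comparison_transpose[OF adj adj' y' g D.comp_in[OF e v]] by simp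
    also have "\<dots> = on_ar H v \<cdot>\<^bsub>C\<^esub> ?t y"
      using adjunctionD(9)[OF adj' g y e v] unfolding comparison_def .
    finally show ?thesis .
  qed
  have iso: "is_iso C (?t y)" if y: "y \<in> Ob D" for y
    using comparison_in[OF adj adj' y] comparison_in[OF adj' adj y]
      comparison_inverse[OF adj adj' y] comparison_inverse[OF adj' adj y]
    unfolding is_iso_def hom_def by auto
  show ?thesis
    unfolding naturally_isomorphic_def natural_transformation_def
    using adjunctionD(2)[OF adj] adjunctionD(2)[OF adj'] comparison_in[OF adj adj'] nat iso
    by blast
qed

section \<open>Binary products\<close>

locale category_with_products = category K for K :: "('o, 'a) cat" (structure) +
  fixes P :: "('o, 'a) products"
  assumes products: "binary_products K P"
begin

lemma hom_Ob: "f \<in> hom K x y \<Longrightarrow> x \<in> Ob K" "f \<in> hom K x y \<Longrightarrow> y \<in> Ob K"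
  using dom_in cod_in by (auto simp: hom_def)

lemma Prod_Ob: "x \<in> Ob K \<Longrightarrow> y \<in> Ob K \<Longrightarrow> Prod P x y \<in> Ob K"
  and Pr1_in: "x \<in> Ob K \<Longrightarrow> y \<in> Ob K \<Longrightarrow> Pr1 P x y \<in> hom K (Prod P x y) x"
  and Pr2_in: "x \<in> Ob K \<Longrightarrow> y \<in> Ob K \<Longrightarrow> Pr2 P x y \<in> hom K (Prod P x y) y"
  using products unfolding binary_products_def by blast+

lemma pair_ex1:
  assumes "f \<in> hom K z x" "g \<in> hom K z y"
  shows "\<exists>!h. h \<in> hom K z (Prod P x y) \<and> Pr1 P x y \<cdot> h = f \<and> Pr2 P x y \<cdot> h = g"
  using products assms hom_Ob[OF assms(1)] hom_Ob[OF assms(2)]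
  unfolding binary_products_def by blast

text \<open>\<open>pair\<close> is a definite description whose factors are read off from the
  codomains of its arguments; the typing assumptions fix these factors, and \<open>pair_ex1\<close>
  makes the description meaningful.\<close>

lemma
  assumes f: "f \<in> hom K z x" and g: "g \<in> hom K z y"
  shows pair_in: "pair K P f g \<in> hom K z (Prod P x y)"
    and Pr1_pair: "Pr1 P x y \<cdot> pair K P f g = f"
    and Pr2_pair: "Pr2 P x y \<cdot> pair K P f g = g"
proof -
  have "pair K P f g =
      (THE h. h \<in> hom K z (Prod P x y) \<and> Pr1 P x y \<cdot> h = f \<and> Pr2 P x y \<cdot> h = g)"
    using f g by (simp add: pair_def hom_def)
  then show "pair K P f g \<in> hom K z (Prod P x y)"
    "Pr1 P x y \<cdot> pair K P f g = f" "Pr2 P x y \<cdot> pair K P f g = g"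
    using theI'[OF pair_ex1[OF f g]] by auto
qed

lemma pair_eta:
  assumes xy: "x \<in> Ob K" "y \<in> Ob K" and h: "h \<in> hom K z (Prod P x y)"
  shows "pair K P (Pr1 P x y \<cdot> h) (Pr2 P x y \<cdot> h) = h"
proof -
  have f: "Pr1 P x y \<cdot> h \<in> hom K z x" and g: "Pr2 P x y \<cdot> h \<in> hom K z y"
    using comp_in[OF h] Pr1_in[OF xy] Pr2_in[OF xy] by auto
  show ?thesis
    using pair_ex1[OF f g] pair_in[OF f g] Pr1_pair[OF f g] Pr2_pair[OF f g] h by blast
qed

text \<open>Surjective pairing is applied to the composite, whose two components are then computed
  by associativity.\<close>

lemma pair_comp:
  assumes f: "f \<in> hom K z x" and g: "g \<in> hom K z y" and h: "h \<in> hom K w z"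
  shows "pair K P f g \<cdot> h = pair K P (f \<cdot> h) (g \<cdot> h)"
proof -
  have xy: "x \<in> Ob K" "y \<in> Ob K" using hom_Ob f g by auto
  have p: "pair K P f g \<in> hom K z (Prod P x y)" using pair_in[OF f g] .
  have "pair K P f g \<cdot> h
      = pair K P (Pr1 P x y \<cdot> (pair K P f g \<cdot> h)) (Pr2 P x y \<cdot> (pair K P f g \<cdot> h))"
    using pair_eta[OF xy comp_in[OF h p]] by simp
  then show ?thesis
    using comp_assoc[OF h p Pr1_in[OF xy]] comp_assoc[OF h p Pr2_in[OF xy]]
      Pr1_pair[OF f g] Pr2_pair[OF f g] by simp
qed

lemma prod_map_eq:
  assumes "f \<in> hom K x x'" and "g \<in> hom K y y'"
  shows "prod_map K P f g = pair K P (f \<cdot> Pr1 P x y) (g \<cdot> Pr2 P x y)"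
  using assms by (simp add: prod_map_def hom_def)

lemma
  assumes f: "f \<in> hom K x x'" and g: "g \<in> hom K y y'"
  shows prod_map_in: "prod_map K P f g \<in> hom K (Prod P x y) (Prod P x' y')"
    and Pr1_prod_map: "Pr1 P x' y' \<cdot> prod_map K P f g = f \<cdot> Pr1 P x y"
    and Pr2_prod_map: "Pr2 P x' y' \<cdot> prod_map K P f g = g \<cdot> Pr2 P x y"
proof -
  have xy: "x \<in> Ob K" "y \<in> Ob K" using hom_Ob f g by auto
  note fg = comp_in[OF Pr1_in[OF xy] f] comp_in[OF Pr2_in[OF xy] g]
  show "prod_map K P f g \<in> hom K (Prod P x y) (Prod P x' y')"
    "Pr1 P x' y' \<cdot> prod_map K P f g = f \<cdot> Pr1 P x y"
    "Pr2 P x' y' \<cdot> prod_map K P f g = g \<cdot> Pr2 P x y"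
    unfolding prod_map_eq[OF f g] by (fact pair_in[OF fg] Pr1_pair[OF fg] Pr2_pair[OF fg])+
qed

lemma prod_map_pair:
  assumes h: "h \<in> hom K w x" and k: "k \<in> hom K w y"
    and f: "f \<in> hom K x x'" and g: "g \<in> hom K y y'"
  shows "prod_map K P f g \<cdot> pair K P h k = pair K P (f \<cdot> h) (g \<cdot> k)"
proof -
  have xy: "x \<in> Ob K" "y \<in> Ob K" using hom_Ob f g by auto
  note p1 = Pr1_in[OF xy] and p2 = Pr2_in[OF xy] and hk = pair_in[OF h k]
  show ?thesis
    unfolding prod_map_eq[OF f g] pair_comp[OF comp_in[OF p1 f] comp_in[OF p2 g] hk]
    using comp_assoc[OF hk p1 f] comp_assoc[OF hk p2 g] Pr1_pair[OF h k] Pr2_pair[OF h k]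
    by simp
qed

lemma prod_map_comp:
  assumes f: "f \<in> hom K x x'" and g: "g \<in> hom K y y'"
    and f': "f' \<in> hom K x' x''" and g': "g' \<in> hom K y' y''"
  shows "prod_map K P f' g' \<cdot> prod_map K P f g = prod_map K P (f' \<cdot> f) (g' \<cdot> g)"
proof -
  have xy: "x \<in> Ob K" "y \<in> Ob K" using hom_Ob f g by auto
  note p1 = Pr1_in[OF xy] and p2 = Pr2_in[OF xy]
  show ?thesis
    unfolding prod_map_eq[OF f g] prod_map_pair[OF comp_in[OF p1 f] comp_in[OF p2 g] f' g']
      prod_map_eq[OF comp_in[OF f f'] comp_in[OF g g']]
    using comp_assoc[OF p1 f f'] comp_assoc[OF p2 g g'] by simp
qed

lemma prod_map_ident_comp:
  assumes "x \<in> Ob K" and "g \<in> hom K y y'" and "g' \<in> hom K y' y''"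
  shows "prod_map K P (Ident K x) g' \<cdot> prod_map K P (Ident K x) g
    = prod_map K P (Ident K x) (g' \<cdot> g)"
  using assms prod_map_comp ident_in ident_left by metis

lemma prod_map_ident:
  assumes xy: "x \<in> Ob K" "y \<in> Ob K"
  shows "prod_map K P (Ident K x) (Ident K y) = Ident K (Prod P x y)"
proof -
  have "prod_map K P (Ident K x) (Ident K y)
      = pair K P (Pr1 P x y \<cdot> Ident K (Prod P x y)) (Pr2 P x y \<cdot> Ident K (Prod P x y))"
    unfolding prod_map_eq[OF ident_in[OF xy(1)] ident_in[OF xy(2)]]
    using ident_left ident_right Pr1_in[OF xy] Pr2_in[OF xy] by simp
  then show ?thesis using pair_eta[OF xy ident_in[OF Prod_Ob[OF xy]]] by simp
qed

section \<open>Composition with the universal Moore machine\<close>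

text \<open>The transition of the universal machine returns its input and forgets its state, so the
  new transition is \<open>(a, (b, e)) \<mapsto> (s (a, e), d (a, e))\<close>. It depends on
  \<open>(b, e)\<close> only through \<open>e\<close>, hence factors through
  \<open>A \<times> \<pi>\<close>, where \<open>\<pi>\<close> projects to \<open>E\<close>.\<close>

lemma ltimes_universal_moore:
  assumes A: "A \<in> Ob K" and B: "B \<in> Ob K" and m: "(E, d, s) \<in> mealy_machines K P A B"
  shows "ltimes_ob K P A (universal_moore K P B) (E, d, s) =
    (Prod P B E, pair K P s d \<cdot> prod_map K P (Ident K A) (Pr2 P B E), Pr1 P B E)"
proof -
  have E: "E \<in> Ob K" and d: "d \<in> hom K (Prod P A E) E" and s: "s \<in> hom K (Prod P A E) B"
    using m by (auto simp: mealy_machines_def)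
  let ?Q = "Prod P B E"
  let ?w = "prod_map K P (Ident K A) (Pr2 P B E)"
  note Q = Prod_Ob[OF B E] and p1 = Pr1_in[OF B E] and p2 = Pr2_in[OF B E]
  note q1 = Pr1_in[OF A Q] and q2 = Pr2_in[OF A Q]
  have w: "?w \<in> hom K (Prod P A ?Q) (Prod P A E)" by (rule prod_map_in[OF ident_in[OF A] p2])
  have ae: "pair K P (Pr1 P A ?Q) (Pr2 P B E \<cdot> Pr2 P A ?Q) = ?w"
    unfolding prod_map_eq[OF ident_in[OF A] p2] ident_left[OF q1] ..
  show ?thesis
    unfolding ltimes_ob_def universal_moore_def
    \<comment> \<open>\<open>Pr1_pair\<close> is the forgetting of the old state;
      \<open>pair_comp\<close> gathers \<open>s\<close> and \<open>d\<close> into a single pairing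
      before \<open>?w\<close>.\<close>
    using Pr1_pair[OF comp_in[OF w s] comp_in[OF q2 p1]] pair_comp[OF s d w] ident_left[OF p1]
    by (simp add: Let_def ae)
qed

lemma ltimes_universal_moore_Ob:
  assumes A: "A \<in> Ob K" and B: "B \<in> Ob K" and m: "m \<in> mealy_machines K P A B"
  shows "ltimes_ob K P A (universal_moore K P B) m \<in> moore_machines K P A B"
proof -
  obtain E d s where m_eq: "m = (E, d, s)" by (cases m)
  have E: "E \<in> Ob K" and d: "d \<in> hom K (Prod P A E) E" and s: "s \<in> hom K (Prod P A E) B"
    using m by (auto simp: m_eq mealy_machines_def)
  note p1 = Pr1_in[OF B E] and p2 = Pr2_in[OF B E]
  show ?thesis
    unfolding m_eq ltimes_universal_moore[OF A B m[unfolded m_eq]]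
    using Prod_Ob[OF B E] p1 comp_in[OF prod_map_in[OF ident_in[OF A] p2] pair_in[OF s d]]
    by (simp add: moore_machines_def)
qed

section \<open>Arrows of machines and functoriality of the composition\<close>

lemma mly_hom:
  "a \<in> hom (Mly K P A B) (E, d, s) (F, d', s') \<longleftrightarrow>
    (E, d, s) \<in> mealy_machines K P A B \<and> (F, d', s') \<in> mealy_machines K P A B \<and>
    (\<exists>f. a = ((E, d, s), f, (F, d', s')) \<and> f \<in> hom K E F \<and>
      f \<cdot> d = d' \<cdot> prod_map K P (Ident K A) f \<and> s' \<cdot> prod_map K P (Ident K A) f = s)"
  unfolding hom_def[of "Mly K P A B"] by (cases a) (auto simp: Mly_def)

lemma mre_hom:
  "a \<in> hom (Mre K P A B) (E, d, s) (F, d', s') \<longleftrightarrow>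
    (E, d, s) \<in> moore_machines K P A B \<and> (F, d', s') \<in> moore_machines K P A B \<and>
    (\<exists>f. a = ((E, d, s), f, (F, d', s')) \<and> f \<in> hom K E F \<and>
      f \<cdot> d = d' \<cdot> prod_map K P (Ident K A) f \<and> s' \<cdot> f = s)"
  unfolding hom_def[of "Mre K P A B"] by (cases a) (auto simp: Mre_def)

text \<open>The two Mealy conditions on \<open>v\<close> say together that
  \<open>B \<times> v\<close> carries the pairing of \<open>s\<close> and \<open>d\<close> to the
  pairing of \<open>s'\<close> and \<open>d'\<close> precomposed with \<open>A \<times> v\<close>.
  Projecting to the second factor commutes with \<open>B \<times> v\<close>, which gives the Moore
  transition square.\<close>

lemma ltimes_universal_moore_map:
  assumes A: "A \<in> Ob K" and B: "B \<in> Ob K" and a: "a \<in> hom (Mly K P A B) m n"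
  shows "on_ar (ltimes_functor K P A (universal_moore K P B)) a \<in>
    hom (Mre K P A B) (ltimes_ob K P A (universal_moore K P B) m)
      (ltimes_ob K P A (universal_moore K P B) n)"
proof -
  obtain E d s where m_eq: "m = (E, d, s)" by (cases m)
  obtain F d' s' where n_eq: "n = (F, d', s')" by (cases n)
  obtain v where m: "(E, d, s) \<in> mealy_machines K P A B"
    and n: "(F, d', s') \<in> mealy_machines K P A B"
    and a_eq: "a = ((E, d, s), v, (F, d', s'))" and v: "v \<in> hom K E F"
    and vd: "v \<cdot> d = d' \<cdot> prod_map K P (Ident K A) v"
    and vs: "s' \<cdot> prod_map K P (Ident K A) v = s"
    using a unfolding m_eq n_eq mly_hom by blast
  have E: "E \<in> Ob K" and d: "d \<in> hom K (Prod P A E) E" and s: "s \<in> hom K (Prod P A E) B"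
    using m by (auto simp: mealy_machines_def)
  have F: "F \<in> Ob K" and d': "d' \<in> hom K (Prod P A F) F" and s': "s' \<in> hom K (Prod P A F) B"
    using n by (auto simp: mealy_machines_def)
  let ?A = "\<lambda>f. prod_map K P (Ident K A) f"
  let ?Bv = "prod_map K P (Ident K B) v"
  note iA = ident_in[OF A] and iB = ident_in[OF B]
  note p1 = Pr1_in[OF B E] and p2 = Pr2_in[OF B E]
  note p1' = Pr1_in[OF B F] and p2' = Pr2_in[OF B F]
  note Bv = prod_map_in[OF iB v] and Av = prod_map_in[OF iA v]
  note w = prod_map_in[OF iA p2] and w' = prod_map_in[OF iA p2']
  note ABv = prod_map_in[OF iA Bv]
  have "?Bv \<cdot> (pair K P s d \<cdot> ?A (Pr2 P B E)) = pair K P s (v \<cdot> d) \<cdot> ?A (Pr2 P B E)"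
    using comp_assoc[OF w pair_in[OF s d] Bv] prod_map_pair[OF s d iB v] ident_left[OF s] by simp
  also have "pair K P s (v \<cdot> d) = pair K P s' d' \<cdot> ?A v"
    using pair_comp[OF s' d' Av] vs vd by simp
  also have "(pair K P s' d' \<cdot> ?A v) \<cdot> ?A (Pr2 P B E)
      = pair K P s' d' \<cdot> (?A v \<cdot> ?A (Pr2 P B E))"
    using comp_assoc[OF w Av pair_in[OF s' d']] by simp
  \<comment> \<open>Naturality of the second projection, under
    \<open>A \<times> (-)\<close>.\<close>
  also have "?A v \<cdot> ?A (Pr2 P B E) = ?A (Pr2 P B F) \<cdot> ?A ?Bv"
    unfolding prod_map_ident_comp[OF A p2 v] prod_map_ident_comp[OF A Bv p2']
      Pr2_prod_map[OF iB v] ..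
  also have "pair K P s' d' \<cdot> (?A (Pr2 P B F) \<cdot> ?A ?Bv)
      = (pair K P s' d' \<cdot> ?A (Pr2 P B F)) \<cdot> ?A ?Bv"
    using comp_assoc[OF ABv w' pair_in[OF s' d']] .
  finally have trans: "?Bv \<cdot> (pair K P s d \<cdot> ?A (Pr2 P B E))
      = (pair K P s' d' \<cdot> ?A (Pr2 P B F)) \<cdot> ?A ?Bv" .
  have fst_universal: "fst (universal_moore K P B) = B" by (simp add: universal_moore_def)
  have out: "Pr1 P B F \<cdot> ?Bv = Pr1 P B E"
    using Pr1_prod_map[OF iB v] ident_left[OF p1] by simp
  show ?thesis
    using ltimes_universal_moore_Ob[OF A B m] ltimes_universal_moore_Ob[OF A B n] Bv trans out
    unfolding m_eq n_eq a_eq ltimes_functor_def ltimes_universal_moore[OF A B m]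
      ltimes_universal_moore[OF A B n] mre_hom
    by (simp add: ltimes_universal_moore[OF A B m] ltimes_universal_moore[OF A B n] fst_universal)
qed

text \<open>The category laws for machines enter as hypotheses: they are contained in the
  functoriality of \<open>D\<^sub>1\<close>, from which they are drawn when the adjunction is
  assembled.\<close>

lemma ltimes_universal_moore_functor:
  assumes A: "A \<in> Ob K" and B: "B \<in> Ob K"
    and cats: "category (Mly K P A B)" "category (Mre K P A B)"
  shows "is_functor (Mly K P A B) (Mre K P A B) (ltimes_functor K P A (universal_moore K P B))"
    (is "is_functor ?C ?D ?L")
  unfolding is_functor_def
proof (intro conjI ballI allI)
  show "category ?C" "category ?D" by fact+
next
  fix m assume "m \<in> Ob ?C"
  then show "on_ob ?L m \<in> Ob ?D"
    using ltimes_universal_moore_Ob[OF A B]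
    by (auto simp: Mly_def Mre_def ltimes_functor_def)
next
  fix m n a assume "a \<in> hom ?C m n"
  then show "on_ar ?L a \<in> hom ?D (on_ob ?L m) (on_ob ?L n)"
    using ltimes_universal_moore_map[OF A B] by (simp add: ltimes_functor_def)
next
  fix m assume m: "m \<in> Ob ?C"
  obtain E d s where m_eq: "m = (E, d, s)" by (cases m)
  have m': "(E, d, s) \<in> mealy_machines K P A B" and E: "E \<in> Ob K"
    using m by (auto simp: m_eq Mly_def mealy_machines_def)
  show "on_ar ?L (Ident ?C m) = Ident ?D (on_ob ?L m)"
    using prod_map_ident[OF B E] ltimes_universal_moore[OF A B m']
    by (simp add: m_eq Mly_def Mre_def ltimes_functor_def universal_moore_def)
next
  fix l m n a b assume a: "a \<in> hom ?C l m" and b: "b \<in> hom ?C m n"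
  obtain E d s where l: "l = (E, d, s)" by (cases l)
  obtain E' d' s' where m: "m = (E', d', s')" by (cases m)
  obtain E'' d'' s'' where n: "n = (E'', d'', s'')" by (cases n)
  obtain f where f: "a = (l, f, m)" "f \<in> hom K E E'" using a unfolding l m mly_hom by blast
  obtain g where g: "b = (m, g, n)" "g \<in> hom K E' E''" using b unfolding m n mly_hom by blast
  show "on_ar ?L (b \<cdot>\<^bsub>?C\<^esub> a) = on_ar ?L b \<cdot>\<^bsub>?D\<^esub> on_ar ?L a"
    using prod_map_ident_comp[OF B f(2) g(2)]
    by (simp add: f(1) g(1) Mly_def Mre_def ltimes_functor_def universal_moore_def)
qed

section \<open>The adjunction\<close>

text \<open>The Moore transition square is an equation between maps into
  \<open>B \<times> F\<close>. Its first component is the Mealy output condition and its second the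
  Mealy transition condition; the Moore output condition holds automatically for a pairing with
  first component \<open>s\<close>.\<close>

lemma mly_hom_iff_mre_hom:
  assumes A: "A \<in> Ob K" and B: "B \<in> Ob K" and X: "(E, d, s) \<in> moore_machines K P A B"
    and M: "(F, d', s') \<in> mealy_machines K P A B" and g: "g \<in> hom K E F"
  shows "(D\<^sub>1_ob K (E, d, s), g, (F, d', s')) \<in> hom (Mly K P A B) (D\<^sub>1_ob K (E, d, s)) (F, d', s')
    \<longleftrightarrow> ((E, d, s), pair K P s g, ltimes_ob K P A (universal_moore K P B) (F, d', s')) \<in>
      hom (Mre K P A B) (E, d, s) (ltimes_ob K P A (universal_moore K P B) (F, d', s'))"
proof -
  have E: "E \<in> Ob K" and d: "d \<in> hom K (Prod P A E) E" and s: "s \<in> hom K E B"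
    using X by (auto simp: moore_machines_def)
  have F: "F \<in> Ob K" and d': "d' \<in> hom K (Prod P A F) F" and s': "s' \<in> hom K (Prod P A F) B"
    using M by (auto simp: mealy_machines_def)
  let ?A = "\<lambda>f. prod_map K P (Ident K A) f"
  let ?h = "pair K P s g"
  note iA = ident_in[OF A] and p2 = Pr2_in[OF B F]
  note h = pair_in[OF s g]
  note Ag = prod_map_in[OF iA g] and Ah = prod_map_in[OF iA h] and w = prod_map_in[OF iA p2]
  note sd = comp_in[OF d s] and gd = comp_in[OF d g]
  note sA = comp_in[OF Ag s'] and dA = comp_in[OF Ag d']
  have lhs: "?h \<cdot> d = pair K P (s \<cdot> d) (g \<cdot> d)" by (rule pair_comp[OF s g d])
  \<comment> \<open>The transition of the composite machine sees only the \<open>F\<close>-component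
    of \<open>?h\<close>, which is \<open>g\<close>.\<close>
  have "(pair K P s' d' \<cdot> ?A (Pr2 P B F)) \<cdot> ?A ?h = pair K P s' d' \<cdot> ?A g"
    using comp_assoc[OF Ah w pair_in[OF s' d']] prod_map_ident_comp[OF A h p2] Pr2_pair[OF s g]
    by simp
  also have "\<dots> = pair K P (s' \<cdot> ?A g) (d' \<cdot> ?A g)" by (rule pair_comp[OF s' d' Ag])
  finally have rhs: "(pair K P s' d' \<cdot> ?A (Pr2 P B F)) \<cdot> ?A ?h
      = pair K P (s' \<cdot> ?A g) (d' \<cdot> ?A g)" .
  have "?h \<cdot> d = (pair K P s' d' \<cdot> ?A (Pr2 P B F)) \<cdot> ?A ?h \<longleftrightarrow>
      s \<cdot> d = s' \<cdot> ?A g \<and> g \<cdot> d = d' \<cdot> ?A g"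
    unfolding lhs rhs
    \<comment> \<open>Composing with the two projections shows that pairings are equal exactly when
      their components are.\<close>
    using Pr1_pair[OF sd gd] Pr2_pair[OF sd gd] Pr1_pair[OF sA dA] Pr2_pair[OF sA dA] by metis
  moreover have "D\<^sub>1_ob K (E, d, s) \<in> mealy_machines K P A B"
    using E d sd by (simp add: D\<^sub>1_ob_def mealy_machines_def)
  ultimately show ?thesis
    using X M g h Pr1_pair[OF s g] ltimes_universal_moore_Ob[OF A B M]
    unfolding ltimes_universal_moore[OF A B M] by (auto simp: D\<^sub>1_ob_def mly_hom mre_hom)
qed

text \<open>\<open>snd (snd X)\<close> is the output map of the Moore machine \<open>X\<close>. The
  ends stored in the argument are dropped, since \<open>X\<close> and \<open>M\<close> determine
  those of the result.\<close>

definition transpose ::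
    "'o \<Rightarrow> 'o \<Rightarrow> ('o, 'a) machine \<Rightarrow> ('o, 'a) machine \<Rightarrow> ('o, 'a) machine_ar \<Rightarrow> ('o, 'a) machine_ar"
  where
  "transpose A B X M = (\<lambda>(_, g, _).
     (X, pair K P (snd (snd X)) g, ltimes_ob K P A (universal_moore K P B) M))"

text \<open>The inverse composes the underlying arrow with the second projection. No information is
  lost, because the Moore output condition already prescribes the first component.\<close>

lemma transpose_bij:
  assumes A: "A \<in> Ob K" and B: "B \<in> Ob K" and X: "X \<in> moore_machines K P A B"
    and M: "M \<in> mealy_machines K P A B"
  shows "bij_betw (transpose A B X M) (hom (Mly K P A B) (D\<^sub>1_ob K X) M)
    (hom (Mre K P A B) X (ltimes_ob K P A (universal_moore K P B) M))"
proof -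
  obtain E d s where X_eq: "X = (E, d, s)" by (cases X)
  obtain F d' s' where M_eq: "M = (F, d', s')" by (cases M)
  have s: "s \<in> hom K E B" and F: "F \<in> Ob K"
    using X M by (auto simp: X_eq M_eq moore_machines_def mealy_machines_def)
  let ?L = "ltimes_ob K P A (universal_moore K P B) M"
  let ?inv = "\<lambda>(_, h, _). (D\<^sub>1_ob K X, Pr2 P B F \<cdot> h, M)"
  note iff = mly_hom_iff_mre_hom[OF A B X[unfolded X_eq] M[unfolded M_eq], folded X_eq M_eq]
  have L: "?L = (Prod P B F, pair K P s' d' \<cdot> prod_map K P (Ident K A) (Pr2 P B F), Pr1 P B F)"
    unfolding M_eq by (rule ltimes_universal_moore[OF A B M[unfolded M_eq]])
  have mly: "\<exists>g \<in> hom K E F. a = (D\<^sub>1_ob K X, g, M)" if "a \<in> hom (Mly K P A B) (D\<^sub>1_ob K X) M" for a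
    using that unfolding X_eq M_eq by (auto simp: D\<^sub>1_ob_def mly_hom)
  \<comment> \<open>Normal form of a Moore arrow into \<open>?L\<close>: its output condition reads
    \<open>Pr1 P B F \<cdot> h = s\<close>, so surjective pairing recovers \<open>h\<close> from
    \<open>s\<close> and \<open>g\<close>.\<close>
  have mre: "\<exists>g \<in> hom K E F. Pr2 P B F \<cdot> h = g \<and> h = pair K P s g \<and> a = (X, pair K P s g, ?L)"
    if "a \<in> hom (Mre K P A B) X ?L" "h = fst (snd a)" for a h
  proof -
    have "a = (X, h, ?L)" and h: "h \<in> hom K E (Prod P B F)" and "Pr1 P B F \<cdot> h = s"
      using that unfolding L X_eq by (auto simp: mre_hom)
    then show ?thesis using pair_eta[OF B F h] comp_in[OF h Pr2_in[OF B F]] by auto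
  qed
  show ?thesis
  proof (rule bij_betw_byWitness[where f' = ?inv])
    show "\<forall>a \<in> hom (Mly K P A B) (D\<^sub>1_ob K X) M. ?inv (transpose A B X M a) = a"
      using mly Pr2_pair[OF s] by (fastforce simp: transpose_def X_eq)
    show "\<forall>a \<in> hom (Mre K P A B) X ?L. transpose A B X M (?inv a) = a"
      using mre by (fastforce simp: transpose_def X_eq)
    show "transpose A B X M ` hom (Mly K P A B) (D\<^sub>1_ob K X) M \<subseteq> hom (Mre K P A B) X ?L"
      using mly iff by (fastforce simp: transpose_def X_eq)
    show "?inv ` hom (Mre K P A B) X ?L \<subseteq> hom (Mly K P A B) (D\<^sub>1_ob K X) M"
    proof
      fix b assume "b \<in> ?inv ` hom (Mre K P A B) X ?L"
      then obtain a where a: "a \<in> hom (Mre K P A B) X ?L" and b: "b = ?inv a" by blast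
      obtain g where g: "g \<in> hom K E F" "Pr2 P B F \<cdot> fst (snd a) = g" "a = (X, pair K P s g, ?L)"
        using mre[OF a refl] by blast
      then have "b = (D\<^sub>1_ob K X, g, M)" using b by auto
      then show "b \<in> hom (Mly K P A B) (D\<^sub>1_ob K X) M" using a g iff by simp
    qed
  qed
qed

theorem ltimes_universal_moore_right_adjoint:
  assumes A: "A \<in> Ob K" and B: "B \<in> Ob K"
    and D1: "is_functor (Mre K P A B) (Mly K P A B) (D\<^sub>1 K)"
  shows "right_adjoint (Mre K P A B) (Mly K P A B) (D\<^sub>1 K)
    (ltimes_functor K P A (universal_moore K P B))"
    (is "right_adjoint ?C ?D _ ?L")
  unfolding right_adjoint_def
proof (intro conjI exI[of _ "transpose A B"] ballI allI)
  have ob: "Ob ?C = moore_machines K P A B" "Ob ?D = mealy_machines K P A B"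
    "on_ob (D\<^sub>1 K) = D\<^sub>1_ob K" "on_ob ?L = ltimes_ob K P A (universal_moore K P B)"
    by (simp_all add: Mre_def Mly_def D\<^sub>1_def ltimes_functor_def)
  show "is_functor ?C ?D (D\<^sub>1 K)" by fact
  show "is_functor ?D ?C ?L"
    \<comment> \<open>Unfolding the functoriality of \<open>D\<^sub>1\<close> supplies the two
      category hypotheses.\<close>
    using ltimes_universal_moore_functor[OF A B] D1 unfolding is_functor_def[of ?C] by blast
  fix X M assume X: "X \<in> Ob ?C" and M: "M \<in> Ob ?D"
  show "bij_betw (transpose A B X M) (hom ?D (on_ob (D\<^sub>1 K) X) M) (hom ?C X (on_ob ?L M))"
    using transpose_bij[OF A B] X M unfolding ob by blast
  fix a assume a: "a \<in> hom ?D (on_ob (D\<^sub>1 K) X) M"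
  obtain E d s where X_eq: "X = (E, d, s)" by (cases X)
  obtain F d' s' where M_eq: "M = (F, d', s')" by (cases M)
  have s: "s \<in> hom K E B" using X unfolding ob X_eq by (simp add: moore_machines_def)
  obtain g where a_eq: "a = (D\<^sub>1_ob K X, g, M)" and g: "g \<in> hom K E F"
    using a unfolding ob X_eq M_eq by (auto simp: D\<^sub>1_ob_def mly_hom)
  {
    fix X' b assume b: "b \<in> hom ?C X' X"
    obtain E' t' s'' where X'_eq: "X' = (E', t', s'')" by (cases X')
    obtain u where b_eq: "b = (X', u, X)" and u: "u \<in> hom K E' E" and su: "s \<cdot> u = s''"
      using b unfolding X_eq X'_eq by (auto simp: mre_hom)
    show "transpose A B X' M (a \<cdot>\<^bsub>?D\<^esub> on_ar (D\<^sub>1 K) b) = transpose A B X M a \<cdot>\<^bsub>?C\<^esub> b"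
      \<comment> \<open>Naturality in the Moore variable: precomposition with \<open>u\<close> turns
        \<open>s\<close> into \<open>s \<cdot> u\<close>, which is the output of \<open>X'\<close>
        because \<open>b\<close> is a Moore morphism.\<close>
      using pair_comp[OF s g u] su
      by (simp add: a_eq b_eq X_eq X'_eq transpose_def Mly_def Mre_def D\<^sub>1_def)
  next
    fix M' b assume b: "b \<in> hom ?D M M'"
    obtain F' t' s'' where M'_eq: "M' = (F', t', s'')" by (cases M')
    obtain v where b_eq: "b = (M, v, M')" and v: "v \<in> hom K F F'"
      using b unfolding M_eq M'_eq by (auto simp: mly_hom)
    show "transpose A B X M' (b \<cdot>\<^bsub>?D\<^esub> a) = on_ar ?L b \<cdot>\<^bsub>?C\<^esub> transpose A B X M a"
      \<comment> \<open>Naturality in the Mealy variable: \<open>B \<times> v\<close> leaves the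
        component \<open>s\<close> unchanged and sends \<open>g\<close> to
        \<open>v \<cdot> g\<close>.\<close>
      using prod_map_pair[OF s g ident_in[OF B] v] ident_left[OF s]
      by (simp add: a_eq b_eq X_eq transpose_def Mly_def Mre_def ltimes_functor_def
          universal_moore_def)
  }
qed

end

theorem theorem3p10:
  fixes K :: "('o, 'a) cat" and P :: "('o, 'a) products" and A B :: 'o
    and K\<^sub>1 :: "('o, 'a) machine_functor"
  assumes "category K"
    and "locally_cartesian_closed K"
    and "locally_presentable TYPE('u) K"
    and "binary_products K P"
    and "A \<in> Ob K" and "B \<in> Ob K"
    and "right_adjoint (Mre K P A B) (Mly K P A B) (D\<^sub>1 K) K\<^sub>1"
  shows "naturally_isomorphic (Mly K P A B) (Mre K P A B)
           K\<^sub>1 (ltimes_functor K P A (universal_moore K P B))"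
proof -
  interpret category_with_products K P
    using assms(1,4) by (simp add: category_with_products_def category_with_products_axioms_def)
  \<comment> \<open>The adjunction assumed for \<open>K\<^sub>1\<close> includes the functoriality
    of \<open>D\<^sub>1\<close>. With it the composition functor becomes a second right adjoint of
    \<open>D\<^sub>1\<close>, and uniqueness applies.\<close>
  have "is_functor (Mre K P A B) (Mly K P A B) (D\<^sub>1 K)"
    using assms(7) by (simp add: right_adjoint_def)
  then show ?thesis
    using right_adjoint_unique[OF assms(7)] ltimes_universal_moore_right_adjoint assms(5,6) by blast
qed

end
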